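(* Let $G=(V,E)$ be a finite graph (parallel edges allowed) with a weight function $w:E\to\mathbb{R}^+$, and let $e_1,e_2\in E$ be two distinct edges. Then $$\|\mathcal{T}_{e_1,\overline{e_2}}\|\,\|\mathcal{T}_{\overline{e_1},e_2}\|\;\geq\;\|\mathcal{T}_{e_1,e_2}\|\,\|\mathcal{T}_{\overline{e_1},\overline{e_2}}\|.$$
   Context: Graphs are multigraphs: two vertices may be connected by several edges. Subgraphs are always spanning and are identified with their edge sets; in particular a spanning tree of $G$ is regarded as a subset of $E$. $\mathbb{R}^+$ denotes the positive reals. For $I\subseteq E$ the weight of $I$ is $w(I)=\prod_{e\in I}w(e)$, and for a family $\mathcal{F}\subseteq 2^E$ its weight is $\|\mathcal{F}\|=\sum_{I\in\mathcal{F}}w(I)$ (so the empty family has weight $0$). $\mathcal{T}_{e_1,e_2}$ is the family of spanning trees of $G$ containing both $e_1$ and $e_2$; $\mathcal{T}_{e_1,\overline{e_2}}$ is the family of spanning trees containing $e_1$ and not $e_2$; $\mathcal{T}_{\overline{e_1},e_2}$ is the family of spanning trees containing $e_2$ and not $e_1$; $\mathcal{T}_{\overline{e_1},\overline{e_2}}$ is the family of spanning trees containing neither $e_1$ nor $e_2$. *)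

theory Defs
  imports Complex_Main "HOL-Library.Uprod"
begin

text \<open>
  Edges are abstract objects, so parallel edges are distinct elements of \<open>E\<close> with the same
  unordered pair of ends. The pair \<open>Upair v v\<close> encodes a loop; loops are permitted.
\<close>

locale finite_multigraph =
  fixes V :: "'v set" and E :: "'e set" and ends :: "'e \<Rightarrow> 'v uprod"
  assumes finite_verts: "finite V"
    and finite_edges: "finite E"
    and ends_in_verts: "e \<in> E \<Longrightarrow> set_uprod (ends e) \<subseteq> V"

text \<open>
  The walk \<open>v\<^sub>0, e\<^sub>1, v\<^sub>1, \<dots>, e\<^sub>k, v\<^sub>k\<close> is represented by its first vertex \<open>v\<^sub>0\<close>,
  the list \<open>[(e\<^sub>1, v\<^sub>1), \<dots>, (e\<^sub>k, v\<^sub>k)]\<close> and its last vertex \<open>v\<^sub>k\<close>.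
\<close>

fun walk :: "('e \<Rightarrow> 'v uprod) \<Rightarrow> 'v \<Rightarrow> ('e \<times> 'v) list \<Rightarrow> 'v \<Rightarrow> bool" where
  "walk ends u [] v \<longleftrightarrow> u = v"
| "walk ends u ((e, x) # p) v \<longleftrightarrow> ends e = Upair u x \<and> walk ends x p v"

definition connected_subgraph :: "'v set \<Rightarrow> ('e \<Rightarrow> 'v uprod) \<Rightarrow> 'e set \<Rightarrow> bool" where
  "connected_subgraph V ends F \<longleftrightarrow>
     V \<noteq> {} \<and> (\<forall>u\<in>V. \<forall>v\<in>V. \<exists>p. walk ends u p v \<and> fst ` set p \<subseteq> F)"

text \<open>
  A loop is a cycle of length 1 and two parallel edges form a cycle of length 2. Distinctness
  of the edges matters only at length 2, where it excludes traversing one edge back and forth.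
\<close>

definition cycle :: "('e \<Rightarrow> 'v uprod) \<Rightarrow> 'v \<Rightarrow> ('e \<times> 'v) list \<Rightarrow> bool" where
  "cycle ends u p \<longleftrightarrow>
     p \<noteq> [] \<and> walk ends u p u \<and> distinct (map fst p) \<and> distinct (map snd p)"

definition acyclic_subgraph :: "('e \<Rightarrow> 'v uprod) \<Rightarrow> 'e set \<Rightarrow> bool" where
  "acyclic_subgraph ends F \<longleftrightarrow> \<not> (\<exists>u p. cycle ends u p \<and> fst ` set p \<subseteq> F)"

definition spanning_trees :: "'v set \<Rightarrow> 'e set \<Rightarrow> ('e \<Rightarrow> 'v uprod) \<Rightarrow> 'e set set" where
  "spanning_trees V E ends =
     {T. T \<subseteq> E \<and> connected_subgraph V ends T \<and> acyclic_subgraph ends T}"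

definition edge_set_weight :: "('e \<Rightarrow> real) \<Rightarrow> 'e set \<Rightarrow> real" where
  "edge_set_weight w I = (\<Prod>e\<in>I. w e)"

definition family_weight :: "('e \<Rightarrow> real) \<Rightarrow> 'e set set \<Rightarrow> real" where
  "family_weight w \<F> = (\<Sum>I\<in>\<F>. edge_set_weight w I)"

end

theory Submission
  imports Defs "HOL-Analysis.Convex"
begin

text \<open>
  The proof is electrical. Write \<open>H = E - {e\<^sub>1, e\<^sub>2}\<close>, let \<open>x, y\<close> be the ends of \<open>e\<^sub>2\<close>, and for
  \<open>K \<subseteq> {e\<^sub>1, e\<^sub>2}\<close> let \<open>t(K)\<close> be the total weight of the \<open>F \<subseteq> H\<close> for which \<open>F \<union> K\<close> is a spanning
  tree. After cancelling \<open>w(e\<^sub>1) w(e\<^sub>2)\<close> the claim reads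
  \<open>t({e\<^sub>1}) t({e\<^sub>2}) \<ge> t({e\<^sub>1, e\<^sub>2}) t({})\<close>. In quotients,
  \<open>t({e\<^sub>1, e\<^sub>2}) / t({e\<^sub>1}) \<le> t({e\<^sub>2}) / t({})\<close>, it is Rayleigh's principle that identifying
  the ends of \<open>e\<^sub>1\<close> does not increase the effective resistance between \<open>x\<close> and \<open>y\<close> in \<open>H\<close>.

  Regard \<open>H\<close> as a network with conductances \<open>w\<close>, and let
  \<open>\<E>(g, h) = (\<Sum>e\<in>H. w(e) (\<partial>\<^sub>e g) (\<partial>\<^sub>e h))\<close> be the Dirichlet form, where \<open>\<partial>\<^sub>e\<close> is the difference
  between the values at the two ends of \<open>e\<close>. Kirchhoff's solution of the network in which the edges
  of \<open>K\<close> are short-circuited is the function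
  \<open>g\<^sub>K(z) = (\<Sum>F. w(F) [z lies in the component of x in F \<union> K])\<close>, the sum being over all \<open>F \<subseteq> H\<close> such
  that \<open>F \<union> K \<union> {e\<^sub>2}\<close> is a spanning tree. It satisfies \<open>g\<^sub>K(x) - g\<^sub>K(y) = t(K \<union> {e\<^sub>2})\<close> and
  (\<open>kirchhoff\<close>) \<open>\<E>(g\<^sub>K, h) = t(K) (h(x) - h(y))\<close> for each \<open>h\<close> that is constant on the edges of \<open>K\<close>.
  The second identity comes from regrouping the sum over pairs \<open>(e, F)\<close> by the tree
  \<open>F \<union> K \<union> {e}\<close>: what is left for each tree is the sum of the increments of \<open>h\<close> along the tree path
  from \<open>x\<close> to \<open>y\<close>, which telescopes.

  Since \<open>g\<^sub>K\<close> with \<open>K = {e\<^sub>1}\<close> is constant on \<open>e\<^sub>1\<close>, the identity evaluates all three terms of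
  the Cauchy-Schwarz inequality \<open>\<E>(g\<^bsub>{}\<^esub>, g\<^bsub>{e\<^sub>1}\<^esub>)\<^sup>2 \<le> \<E>(g\<^bsub>{}\<^esub>, g\<^bsub>{}\<^esub>) \<E>(g\<^bsub>{e\<^sub>1}\<^esub>, g\<^bsub>{e\<^sub>1}\<^esub>)\<close>, and gives
  \<open>(t({}) t({e\<^sub>1, e\<^sub>2}))\<^sup>2 \<le> t({}) t({e\<^sub>2}) t({e\<^sub>1}) t({e\<^sub>1, e\<^sub>2})\<close>. Cancel the factor
  \<open>t({}) t({e\<^sub>1, e\<^sub>2})\<close>; where it vanishes, the claim is trivial.
\<close>

section \<open>Linked vertices\<close>

definition linked :: "('e \<Rightarrow> 'v uprod) \<Rightarrow> 'e set \<Rightarrow> 'v \<Rightarrow> 'v \<Rightarrow> bool" where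
  "linked ends F u v \<longleftrightarrow> (\<exists>p. walk ends u p v \<and> fst ` set p \<subseteq> F)"

lemma linked_refl [simp]: "linked ends F u u"
  unfolding linked_def by (rule exI[of _ "[]"]) simp

lemma linked_edge: "e \<in> F \<Longrightarrow> ends e = Upair u v \<Longrightarrow> linked ends F u v"
  unfolding linked_def by (rule exI[of _ "[(e, v)]"]) simp

lemma walk_append: "walk ends u p v \<Longrightarrow> walk ends v q x \<Longrightarrow> walk ends u (p @ q) x"
  by (induction ends u p v rule: walk.induct) auto

lemma linked_trans: "linked ends F u v \<Longrightarrow> linked ends F v x \<Longrightarrow> linked ends F u x"
  unfolding linked_def by (metis walk_append image_Un le_sup_iff set_append)

lemma linked_mono: "linked ends F u v \<Longrightarrow> F \<subseteq> F' \<Longrightarrow> linked ends F' u v"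
  unfolding linked_def by blast

lemma linked_induct [consumes 1, case_names refl step]:
  assumes "linked ends F u v"
    and "\<And>u. P u u"
    and "\<And>e u x v. \<lbrakk>e \<in> F; ends e = Upair u x; linked ends F x v; P x v\<rbrakk> \<Longrightarrow> P u v"
  shows "P u v"
proof -
  obtain p where "walk ends u p v" "fst ` set p \<subseteq> F"
    using assms(1) unfolding linked_def by blast
  then show ?thesis
  proof (induction p arbitrary: u)
    case Nil
    then show ?case using assms(2) by simp
  next
    case (Cons a p)
    obtain e x where a: "a = (e, x)" by force
    have "linked ends F x v"
      unfolding linked_def using Cons.prems a by auto
    then show ?case using Cons.IH[of x] Cons.prems a assms(3)[of e u x v] by auto
  qed
qed

lemma linked_sym: "linked ends F u v \<Longrightarrow> linked ends F v u"
proof (induction rule: linked_induct)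
  case (step e u x v)
  then have "linked ends F x u" by (metis linked_edge Upair_inject)
  then show ?case using step linked_trans by metis
qed simp

lemma linked_insertE:
  assumes "linked ends (insert e F) u v" and e: "ends e = Upair a b"
  obtains "linked ends F u v"
    | "linked ends F u a" "linked ends F b v"
    | "linked ends F u b" "linked ends F a v"
proof -
  from assms(1)
  have "linked ends F u v \<or> (linked ends F u a \<and> linked ends F b v)
      \<or> (linked ends F u b \<and> linked ends F a v)"
  proof (induction rule: linked_induct)
    case (step f u x v)
    show ?case
    proof (cases "f = e")
      case True
      then have "(u = a \<and> x = b) \<or> (u = b \<and> x = a)" using step e by auto
      then show ?thesis using step.IH by (metis linked_refl linked_trans linked_sym)
    next
      case False
      then have "linked ends F u x" using step by (meson insertE linked_edge)
      then show ?thesis using step.IH linked_trans by metis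
    qed
  qed simp
  then show ?thesis using that by blast
qed

section \<open>Acyclic edge sets and exchange\<close>

lemma walk_suffix_at:
  assumes "walk ends x q v" "distinct (x # map snd q)" "u \<in> set (x # map snd q)"
  shows "\<exists>q'. walk ends u q' v \<and> distinct (u # map snd q') \<and> set q' \<subseteq> set q"
  using assms
proof (induction q arbitrary: x)
  case Nil
  then show ?case by (intro exI[of _ "[]"]) auto
next
  case (Cons a q)
  obtain e z where a: "a = (e, z)" by force
  show ?case
  proof (cases "u = x")
    case True
    then show ?thesis using Cons.prems by (intro exI[of _ "a # q"]) auto
  next
    case False
    then have "\<exists>q'. walk ends u q' v \<and> distinct (u # map snd q') \<and> set q' \<subseteq> set q"
      using Cons a by (intro Cons.IH[of z]) auto
    then show ?thesis by (meson set_subset_Cons subset_trans)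
  qed
qed

lemma linked_imp_simple_walk:
  assumes "linked ends F u v"
  shows "\<exists>p. walk ends u p v \<and> distinct (u # map snd p) \<and> fst ` set p \<subseteq> F"
  using assms
proof (induction rule: linked_induct)
  case (refl u)
  then show ?case by (intro exI[of _ "[]"]) auto
next
  case (step e u x v)
  then obtain p where p: "walk ends x p v" "distinct (x # map snd p)" "fst ` set p \<subseteq> F"
    by blast
  show ?case
  proof (cases "u \<in> set (x # map snd p)")
    case True
    then obtain q where "walk ends u q v" "distinct (u # map snd q)" "set q \<subseteq> set p"
      using walk_suffix_at[OF p(1,2)] by blast
    then show ?thesis using p(3) by (meson image_mono subset_trans)
  next
    case False
    then show ?thesis using p step by (intro exI[of _ "(e, x) # p"]) auto
  qed
qed

lemma walk_edge_ends:
  assumes "walk ends x p v" "e \<in> fst ` set p"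
  shows "set_uprod (ends e) \<subseteq> set (x # map snd p)"
  using assms by (induction ends x p v rule: walk.induct) auto

lemma simple_walk_distinct_edges:
  assumes "walk ends u p v" "distinct (u # map snd p)"
  shows "distinct (map fst p)"
  using assms
proof (induction ends u p v rule: walk.induct)
  case (2 ends u e x p v)
  have "e \<notin> fst ` set p"
  proof
    assume "e \<in> fst ` set p"
    then have "set_uprod (ends e) \<subseteq> set (x # map snd p)"
      using 2 by (intro walk_edge_ends[of _ _ _ v]) auto
    then show False using 2 by auto
  qed
  then show ?case using 2 by auto
qed simp

text \<open>
  A cycle through \<open>e\<close> leaves, on removal of \<open>e\<close>, a walk between the ends of \<open>e\<close>; conversely a
  simple walk between the ends of \<open>e\<close> that avoids \<open>e\<close> is closed up by \<open>e\<close>. All later arguments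
  use acyclicity in this form.
\<close>

lemma acyclic_subgraph_iff:
  "acyclic_subgraph ends F \<longleftrightarrow>
     (\<forall>e\<in>F. \<forall>u v. ends e = Upair u v \<longrightarrow> \<not> linked ends (F - {e}) u v)"
proof
  assume ac: "acyclic_subgraph ends F"
  show "\<forall>e\<in>F. \<forall>u v. ends e = Upair u v \<longrightarrow> \<not> linked ends (F - {e}) u v"
  proof (intro ballI allI impI notI)
    fix e u v
    assume e: "e \<in> F" "ends e = Upair u v" and "linked ends (F - {e}) u v"
    from linked_imp_simple_walk[OF this(3)] obtain p
      where p: "walk ends u p v" "distinct (u # map snd p)" "fst ` set p \<subseteq> F - {e}" by blast
    have "distinct (map fst p)" using simple_walk_distinct_edges[OF p(1,2)] .
    then have "cycle ends v ((e, u) # p)"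
      using p e by (auto simp: cycle_def)
    moreover have "fst ` set ((e, u) # p) \<subseteq> F" using p e by auto
    ultimately show False using ac unfolding acyclic_subgraph_def by blast
  qed
next
  assume nl: "\<forall>e\<in>F. \<forall>u v. ends e = Upair u v \<longrightarrow> \<not> linked ends (F - {e}) u v"
  show "acyclic_subgraph ends F"
    unfolding acyclic_subgraph_def
  proof (intro notI, elim exE conjE)
    fix u p
    assume c: "cycle ends u p" and F: "fst ` set p \<subseteq> F"
    obtain e x q where p: "p = (e, x) # q"
      using c unfolding cycle_def by (cases p) auto
    have "ends e = Upair u x" "walk ends x q u" "e \<notin> fst ` set q"
      using c p unfolding cycle_def by auto
    moreover from this have "linked ends (F - {e}) x u"
      unfolding linked_def using F p by auto
    ultimately show False using nl F p by (auto dest: linked_sym)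
  qed
qed

definition spanning_tree :: "'v set \<Rightarrow> ('e \<Rightarrow> 'v uprod) \<Rightarrow> 'e set \<Rightarrow> bool" where
  "spanning_tree V ends S \<longleftrightarrow> connected_subgraph V ends S \<and> acyclic_subgraph ends S"

lemma spanning_tree_linked:
  "spanning_tree V ends S \<Longrightarrow> u \<in> V \<Longrightarrow> v \<in> V \<Longrightarrow> linked ends S u v"
  unfolding spanning_tree_def connected_subgraph_def linked_def by blast

lemma spanning_tree_not_linked:
  "spanning_tree V ends (insert e M) \<Longrightarrow> e \<notin> M \<Longrightarrow> ends e = Upair u v \<Longrightarrow> \<not> linked ends M u v"
  unfolding spanning_tree_def acyclic_subgraph_iff by (metis Diff_insert_absorb insertI1)

lemma spanning_tree_remove_two_components:
  assumes "spanning_tree V ends (insert b M)" and b: "ends b = Upair x y"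
    and "x \<in> V" "z \<in> V"
  shows "linked ends M z x \<or> linked ends M z y"
proof -
  have "linked ends (insert b M) z x" using assms spanning_tree_linked by metis
  then show ?thesis using b by (auto elim: linked_insertE)
qed

text \<open>
  Removing \<open>b\<close> from a spanning tree leaves two components, and any edge between them reconnects
  the graph. A cycle created by the new edge \<open>e\<close> would use \<open>e\<close> and hence link its ends inside \<open>M\<close>.
\<close>

lemma spanning_tree_exchange:
  assumes tree: "spanning_tree V ends (insert b M)"
    and b: "ends b = Upair x y" "x \<in> V" "y \<in> V"
    and e: "ends e = Upair u v" "u \<in> V" "v \<in> V"
    and "b \<notin> M" and nuv: "\<not> linked ends M u v"
  shows "spanning_tree V ends (insert e M)"
proof -
  let ?N = "insert e M"
  note two = spanning_tree_remove_two_components[OF tree b(1,2)]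
  have MN: "linked ends ?N p q" if "linked ends M p q" for p q
    using that linked_mono by (metis subset_insertI)
  have uv: "linked ends ?N u v" using e by (intro linked_edge) auto
  have xy: "linked ends ?N x y"
  proof -
    consider "linked ends M u x" "linked ends M v y" | "linked ends M u y" "linked ends M v x"
      using two[of u] two[of v] e nuv by (metis linked_sym linked_trans)
    then show ?thesis using uv by cases (meson MN linked_sym linked_trans)+
  qed
  have "linked ends ?N z x" if "z \<in> V" for z
    using two[OF that] xy by (meson MN linked_sym linked_trans)
  then have "connected_subgraph V ends ?N"
    unfolding connected_subgraph_def linked_def[symmetric]
    using b by (metis linked_sym linked_trans empty_iff)
  moreover have "acyclic_subgraph ends ?N"
    unfolding acyclic_subgraph_iff
  proof (intro ballI allI impI notI)
    fix f p q
    assume f: "f \<in> ?N" "ends f = Upair p q" and l: "linked ends (?N - {f}) p q"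
    show False
    proof (cases "f = e")
      case True
      then have "linked ends M p q" using l by (rule_tac linked_mono) auto
      then show False using True e f nuv by (auto dest: linked_sym)
    next
      case False
      then have fM: "f \<in> M" using f by auto
      have l': "linked ends (insert e (M - {f})) p q"
        using l False by (simp add: insert_Diff_if)
      have "\<not> linked ends (insert b M - {f}) p q"
        using tree fM f unfolding spanning_tree_def acyclic_subgraph_iff by auto
      then have n: "\<not> linked ends (M - {f}) p q"
        using linked_mono[of ends "M - {f}" p q "insert b M - {f}"] by auto
      have sub: "linked ends M a c" if "linked ends (M - {f}) a c" for a c
        using that linked_mono by (metis Diff_subset)
      have pq: "linked ends M p q" using fM f by (intro linked_edge)
      from l' e(1) show False
      proof (cases rule: linked_insertE)
        case 1
        then show False using n by blast
      next
        case 2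
        then have "linked ends M u p" "linked ends M q v" using sub linked_sym by metis+
        then show False using pq nuv linked_trans by metis
      next
        case 3
        then have "linked ends M u q" "linked ends M p v" using sub linked_sym by metis+
        then show False using linked_sym[OF pq] nuv linked_trans by metis
      qed
    qed
  qed
  ultimately show ?thesis unfolding spanning_tree_def by blast
qed

section \<open>Kirchhoff's potentials\<close>

text \<open>
  An orientation of every edge fixes the sign of the differences \<open>h (tail e) - h (head e)\<close>.
\<close>

locale oriented_network = finite_multigraph V E ends
  for V :: "'v set" and E :: "'e set" and ends :: "'e \<Rightarrow> 'v uprod" +
  fixes tail head :: "'e \<Rightarrow> 'v" and w :: "'e \<Rightarrow> real"
  assumes ends_eq: "ends e = Upair (tail e) (head e)"
    and weight_pos: "e \<in> E \<Longrightarrow> w e > 0"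
begin

abbreviation diff :: "('v \<Rightarrow> real) \<Rightarrow> 'e \<Rightarrow> real" where
  "diff h e \<equiv> h (tail e) - h (head e)"

definition dirichlet :: "'e set \<Rightarrow> ('v \<Rightarrow> real) \<Rightarrow> ('v \<Rightarrow> real) \<Rightarrow> real" where
  "dirichlet H g h = (\<Sum>e\<in>H. w e * diff g e * diff h e)"

definition completions :: "'e set \<Rightarrow> 'e set \<Rightarrow> 'e set set" where
  "completions H K = {F. F \<subseteq> H \<and> spanning_tree V ends (F \<union> K)}"

text \<open>
  Up to scaling this is the voltage at \<open>z\<close>, with \<open>head b\<close> at voltage 0, when the edges of \<open>K\<close> are
  short-circuited and a current enters at \<open>tail b\<close> and leaves at \<open>head b\<close>. The scaling avoids
  division by the weight of the trees, which may be 0.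
\<close>

definition potential :: "'e set \<Rightarrow> 'e set \<Rightarrow> 'e \<Rightarrow> 'v \<Rightarrow> real" where
  "potential H K b z = (\<Sum>F\<in>completions H (insert b K).
     edge_set_weight w F * of_bool (linked ends (F \<union> K) z (tail b)))"

lemma tail_head_in_verts: "e \<in> E \<Longrightarrow> tail e \<in> V \<and> head e \<in> V"
  using ends_in_verts[of e] ends_eq[of e] by auto

lemma linked_tail_head: "e \<in> F \<Longrightarrow> linked ends F (tail e) (head e)"
  using linked_edge ends_eq by metis

lemma finite_completions: "H \<subseteq> E \<Longrightarrow> finite (completions H K)"
  unfolding completions_def using finite_edges
  by (metis (no_types, lifting) finite_Collect_subsets finite_subset mem_Collect_eq subsetI)

lemma family_weight_completions_nonneg:
  assumes "H \<subseteq> E"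
  shows "family_weight w (completions H K) \<ge> 0"
  unfolding family_weight_def edge_set_weight_def completions_def
  using assms weight_pos by (intro sum_nonneg prod_nonneg) (auto intro: less_imp_le)

text \<open>
  The coefficient of \<open>diff h e\<close> is \<open>1\<close>, \<open>-1\<close> or \<open>0\<close> according as the tree path from \<open>x\<close> to \<open>y\<close>
  uses \<open>e\<close> forwards, backwards or not at all, so the sum telescopes along this path. In the form
  chosen here the coefficient is additive in \<open>(x, y)\<close>, which reduces the claim to adjacent \<open>x\<close>
  and \<open>y\<close>, where only the edge joining them contributes.
\<close>

lemma tree_path_telescope:
  assumes tree: "spanning_tree V ends S" and "finite S" and "x \<in> V" "y \<in> V"
  shows "(\<Sum>e\<in>S. (of_bool (linked ends (S - {e}) (tail e) x)
                 - of_bool (linked ends (S - {e}) (tail e) y)) * diff h e) = h x - h y"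
proof -
  let ?c = "\<lambda>e z. of_bool (linked ends (S - {e}) (tail e) z) :: real"
  have "linked ends S x y" using assms spanning_tree_linked by metis
  then show ?thesis
  proof (induction rule: linked_induct)
    case (step f x z y)
    have rest: "?c e x = ?c e z" if "e \<noteq> f" for e
    proof -
      have "linked ends (S - {e}) x z" using step that by (intro linked_edge) auto
      then have "linked ends (S - {e}) (tail e) x = linked ends (S - {e}) (tail e) z"
        by (metis linked_sym linked_trans)
      then show ?thesis by simp
    qed
    have "\<not> linked ends (S - {f}) (tail f) (head f)"
      using tree step ends_eq unfolding spanning_tree_def acyclic_subgraph_iff by blast
    then have f: "(?c f x - ?c f z) * diff h f = h x - h z"
      using step ends_eq[of f] by auto
    have "(\<Sum>e\<in>S. (?c e x - ?c e z) * diff h e) = (\<Sum>e\<in>{f}. (?c e x - ?c e z) * diff h e)"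
      using step rest \<open>finite S\<close> by (intro sum.mono_neutral_right) auto
    then have "(\<Sum>e\<in>S. (?c e x - ?c e z) * diff h e) = h x - h z" using f by simp
    moreover have "(\<Sum>e\<in>S. (?c e x - ?c e y) * diff h e) =
        (\<Sum>e\<in>S. (?c e x - ?c e z) * diff h e) + (\<Sum>e\<in>S. (?c e z - ?c e y) * diff h e)"
      by (simp add: sum.distrib[symmetric] algebra_simps)
    ultimately show ?case using step.IH by simp
  qed simp
qed

text \<open>
  Both sides are sums over pairs of an edge \<open>e\<close> and a spanning tree through \<open>e\<close>: a forest \<open>F\<close>
  counted by the potential and an edge \<open>e\<close> between its two components correspond to the tree
  \<open>F \<union> K \<union> {e}\<close> together with \<open>e\<close>, an edge of its path between the ends of \<open>b\<close>; exchange gives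
  both directions.
\<close>

lemma kirchhoff:
  assumes HE: "H \<subseteq> E" and KE: "K \<subseteq> E" and HK: "H \<inter> K = {}"
    and b: "b \<in> E" "b \<notin> H" "b \<notin> K"
    and const: "\<And>e. e \<in> K \<Longrightarrow> diff h e = 0"
  shows "dirichlet H (potential H K b) h = family_weight w (completions H K) * diff h b"
proof -
  define x y where "x = tail b" and "y = head b"
  have bxy: "ends b = Upair x y" "x \<in> V" "y \<in> V"
    using ends_eq tail_head_in_verts b by (auto simp: x_def y_def)
  let ?P = "completions H (insert b K)" and ?Q = "completions H K"
  let ?L = "\<lambda>M u v. linked ends M u v"
  have fin: "finite H" "finite K" "finite ?P" "finite ?Q"
    using finite_edges HE KE finite_subset finite_completions by auto
  define \<phi> where "\<phi> = (\<lambda>(e, F). w e * edge_set_weight w F *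
     (of_bool (?L (F \<union> K) (tail e) x) - of_bool (?L (F \<union> K) (head e) x)) * diff h e)"
  define \<psi> where "\<psi> = (\<lambda>(T, e). edge_set_weight w T *
     ((of_bool (?L (T \<union> K - {e}) (tail e) x) - of_bool (?L (T \<union> K - {e}) (tail e) y)) * diff h e))"
  define X where "X = {(e, F). e \<in> H \<and> F \<in> ?P \<and> \<not> ?L (F \<union> K) (tail e) (head e)}"
  define Y where "Y = {(T, e). T \<in> ?Q \<and> e \<in> T \<and> \<not> ?L (T \<union> K - {e}) x y}"
  have forward: "e \<notin> F" "(insert e F, e) \<in> Y" "\<psi> (insert e F, e) = \<phi> (e, F)" if X: "(e, F) \<in> X" for e F
  proof -
    have e: "e \<in> H" "\<not> ?L (F \<union> K) (tail e) (head e)"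
      and F: "F \<subseteq> H" and tree: "spanning_tree V ends (insert b (F \<union> K))"
      using X unfolding X_def completions_def by auto
    have eV: "tail e \<in> V" "head e \<in> V" using e HE tail_head_in_verts by auto
    have bFK: "b \<notin> F \<union> K" using F b by auto
    show eF: "e \<notin> F" using e linked_tail_head[of e "F \<union> K"] by auto
    have "spanning_tree V ends (insert e (F \<union> K))"
      using spanning_tree_exchange[OF tree bxy ends_eq eV bFK] e by blast
    then have Q: "insert e F \<in> ?Q" using e F unfolding completions_def by auto
    have nxy: "\<not> ?L (F \<union> K) x y"
      using spanning_tree_not_linked[OF tree bFK bxy(1)] .
    have S: "insert e F \<union> K - {e} = F \<union> K" using eF e HK by auto
    show "(insert e F, e) \<in> Y"
      unfolding Y_def using Q nxy by (simp only: mem_Collect_eq prod.case S) simp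
    \<comment> \<open>As \<open>F \<union> K\<close> has exactly two components, the head of \<open>e\<close> is on the side of \<open>x\<close>
       iff the tail is on the side of \<open>y\<close>.\<close>
    note two = spanning_tree_remove_two_components[OF tree bxy(1,2)]
    have "?L (F \<union> K) (head e) x = ?L (F \<union> K) (tail e) y"
      using two[OF eV(1)] two[OF eV(2)] e(2) nxy by (metis linked_sym linked_trans)
    moreover have "edge_set_weight w (insert e F) = w e * edge_set_weight w F"
      unfolding edge_set_weight_def using eF F fin finite_subset by (metis prod.insert)
    ultimately show "\<psi> (insert e F, e) = \<phi> (e, F)"
      unfolding \<phi>_def \<psi>_def using S by simp
  qed
  have backward: "(e, T - {e}) \<in> X" if Y: "(T, e) \<in> Y" for e T
  proof -
    have e: "e \<in> T" "\<not> ?L (T \<union> K - {e}) x y"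
      and T: "T \<subseteq> H" and tree: "spanning_tree V ends (T \<union> K)"
      using Y unfolding Y_def completions_def by auto
    have eV: "tail e \<in> V" "head e \<in> V" using e T HE tail_head_in_verts by auto
    have S: "T - {e} \<union> K = T \<union> K - {e}" "insert e (T - {e} \<union> K) = T \<union> K"
      using e T HK by auto
    have tree': "spanning_tree V ends (insert e (T - {e} \<union> K))" using tree S by simp
    have eN: "e \<notin> T - {e} \<union> K" using e T HK by auto
    have "spanning_tree V ends (insert b (T - {e} \<union> K))"
      using spanning_tree_exchange[OF tree' ends_eq eV bxy eN] e(2) S by simp
    moreover have "\<not> ?L (T - {e} \<union> K) (tail e) (head e)"
      using spanning_tree_not_linked[OF tree' eN ends_eq] .
    ultimately show ?thesis using e T unfolding X_def completions_def by auto
  qed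
  have bij: "bij_betw (\<lambda>(e, F). (insert e F, e)) X Y"
  proof (rule bij_betw_byWitness[where f' = "\<lambda>(T, e). (e, T - {e})"])
    show "(\<lambda>(e, F). (insert e F, e)) ` X \<subseteq> Y"
      using forward(2) by auto
    show "\<forall>a\<in>X. (\<lambda>(T, e). (e, T - {e})) ((\<lambda>(e, F). (insert e F, e)) a) = a"
      using forward(1) by auto
    show "\<forall>a\<in>Y. (\<lambda>(e, F). (insert e F, e)) ((\<lambda>(T, e). (e, T - {e})) a) = a"
      unfolding Y_def by auto
    show "(\<lambda>(T, e). (e, T - {e})) ` Y \<subseteq> X"
      using backward by auto
  qed
  have "dirichlet H (potential H K b) h = (\<Sum>e\<in>H. \<Sum>F\<in>?P. \<phi> (e, F))"
    unfolding dirichlet_def potential_def \<phi>_def x_def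
    by (simp add: sum_subtractf[symmetric] sum_distrib_left sum_distrib_right algebra_simps)
  also have "\<dots> = sum \<phi> (H \<times> ?P)"
    by (simp add: sum.cartesian_product)
  also have "\<dots> = sum \<phi> X"
  proof (rule sum.mono_neutral_right)
    show "\<forall>i\<in>H \<times> ?P - X. \<phi> i = 0"
    proof
      fix i assume "i \<in> H \<times> ?P - X"
      then obtain e F where i: "i = (e, F)" and l: "?L (F \<union> K) (tail e) (head e)"
        unfolding X_def by auto
      have "?L (F \<union> K) (tail e) x = ?L (F \<union> K) (head e) x"
        using l by (metis linked_sym linked_trans)
      then show "\<phi> i = 0" unfolding \<phi>_def i by simp
    qed
  qed (use fin in \<open>auto simp: X_def\<close>)
  also have "\<dots> = sum \<psi> Y"
    unfolding sum.reindex_bij_betw[OF bij, of \<psi>, symmetric]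
    by (rule sum.cong) (auto simp: forward(3))
  also have "\<dots> = sum \<psi> (Sigma ?Q (\<lambda>T. T))"
  proof (rule sum.mono_neutral_left)
    show "finite (Sigma ?Q (\<lambda>T. T))"
      using fin by (intro finite_SigmaI) (auto simp: completions_def intro: finite_subset)
    show "\<forall>i\<in>Sigma ?Q (\<lambda>T. T) - Y. \<psi> i = 0"
    proof
      fix i assume "i \<in> Sigma ?Q (\<lambda>T. T) - Y"
      then obtain T e where i: "i = (T, e)" and l: "?L (T \<union> K - {e}) x y"
        unfolding Y_def by auto
      have "?L (T \<union> K - {e}) (tail e) x = ?L (T \<union> K - {e}) (tail e) y"
        using l by (metis linked_sym linked_trans)
      then show "\<psi> i = 0" unfolding \<psi>_def i by simp
    qed
  qed (auto simp: Y_def)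
  also have "\<dots> = (\<Sum>T\<in>?Q. \<Sum>e\<in>T. \<psi> (T, e))"
    using fin by (subst sum.Sigma) (auto simp: completions_def intro: finite_subset)
  also have "\<dots> = (\<Sum>T\<in>?Q. edge_set_weight w T * (h x - h y))"
  proof (rule sum.cong)
    fix T assume T: "T \<in> ?Q"
    then have fT: "finite (T \<union> K)" and tree: "spanning_tree V ends (T \<union> K)"
      using fin unfolding completions_def by (auto intro: finite_subset)
    let ?t = "\<lambda>e. (of_bool (?L (T \<union> K - {e}) (tail e) x)
                 - of_bool (?L (T \<union> K - {e}) (tail e) y)) * diff h e"
    have "(\<Sum>e\<in>T. ?t e) = (\<Sum>e\<in>T \<union> K. ?t e)"
      using fT const by (intro sum.mono_neutral_left) auto
    then have "(\<Sum>e\<in>T. ?t e) = h x - h y"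
      using tree_path_telescope[OF tree fT bxy(2,3)] by simp
    then show "(\<Sum>e\<in>T. \<psi> (T, e)) = edge_set_weight w T * (h x - h y)"
      unfolding \<psi>_def by (simp add: sum_distrib_left[symmetric])
  qed simp
  finally show ?thesis
    unfolding family_weight_def x_def y_def by (simp add: sum_distrib_right)
qed

lemma diff_potential:
  assumes "b \<notin> H" "b \<notin> K"
  shows "diff (potential H K b) b = family_weight w (completions H (insert b K))"
proof -
  have "\<not> linked ends (F \<union> K) (head b) (tail b)" if "F \<in> completions H (insert b K)" for F
  proof -
    have "spanning_tree V ends (insert b (F \<union> K))" "b \<notin> F \<union> K"
      using that assms unfolding completions_def by auto
    from spanning_tree_not_linked[OF this ends_eq] show ?thesis by (metis linked_sym)
  qed
  then show ?thesis
    unfolding potential_def family_weight_def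
    by (auto simp: sum_subtractf[symmetric] intro!: sum.cong)
qed

lemma diff_potential_short_circuited:
  assumes "e \<in> K"
  shows "diff (potential H K b) e = 0"
proof -
  have "linked ends (F \<union> K) (tail e) (tail b) = linked ends (F \<union> K) (head e) (tail b)" for F
    using linked_tail_head[of e "F \<union> K"] assms by (metis UnCI linked_sym linked_trans)
  then show ?thesis unfolding potential_def by simp
qed

lemma dirichlet_cauchy_schwarz:
  assumes "H \<subseteq> E"
  shows "(dirichlet H g h)\<^sup>2 \<le> dirichlet H g g * dirichlet H h h"
proof -
  have w: "w e \<ge> 0" if "e \<in> H" for e using that assms weight_pos by (meson less_imp_le subsetD)
  have "(\<Sum>e\<in>H. (sqrt (w e) * diff g e) * (sqrt (w e) * diff h e))\<^sup>2
      \<le> (\<Sum>e\<in>H. (sqrt (w e) * diff g e)\<^sup>2) * (\<Sum>e\<in>H. (sqrt (w e) * diff h e)\<^sup>2)"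
    by (rule Cauchy_Schwarz_ineq_sum)
  moreover have "(\<Sum>e\<in>H. (sqrt (w e) * diff p e) * (sqrt (w e) * diff q e)) = dirichlet H p q" for p q
    unfolding dirichlet_def
  proof (rule sum.cong)
    fix e assume "e \<in> H"
    then have "sqrt (w e) * sqrt (w e) = w e" using w by simp
    then show "(sqrt (w e) * diff p e) * (sqrt (w e) * diff q e) = w e * diff p e * diff q e"
      by (metis mult.assoc mult.left_commute)
  qed simp
  ultimately show ?thesis by (simp add: power2_eq_square)
qed

text \<open>
  This is Rayleigh's principle for \<open>H\<close> and its contraction by \<open>a\<close>. A potential of the contraction
  is also a function on the vertices of \<open>H\<close>, so \<open>kirchhoff\<close> gives both its own energy and its
  energy against the potential of \<open>H\<close>, and Cauchy-Schwarz compares the two.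
\<close>

lemma completions_rayleigh:
  assumes HE: "H \<subseteq> E" and a: "a \<in> E" "a \<notin> H" and b: "b \<in> E" "b \<notin> H" and ab: "a \<noteq> b"
  shows "family_weight w (completions H {a, b}) * family_weight w (completions H {})
       \<le> family_weight w (completions H {a}) * family_weight w (completions H {b})"
proof -
  define A B C D where
    "A = family_weight w (completions H {a})" and "B = family_weight w (completions H {b})" and
    "C = family_weight w (completions H {a, b})" and "D = family_weight w (completions H {})"
  have nonneg: "A \<ge> 0" "B \<ge> 0" "C \<ge> 0" "D \<ge> 0"
    unfolding A_def B_def C_def D_def using family_weight_completions_nonneg[OF HE] by auto
  let ?g = "potential H {} b" and ?f = "potential H {a} b"
  have drop: "diff ?g b = B" "diff ?f b = C"
    using diff_potential[of b H "{}"] diff_potential[of b H "{a}"] b ab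
    unfolding B_def C_def by (auto simp: insert_commute)
  have "dirichlet H ?g h = D * diff h b" for h
    unfolding D_def using kirchhoff[of H "{}" b h] HE b by auto
  moreover have "dirichlet H ?f ?f = A * diff ?f b"
    unfolding A_def using HE a b ab diff_potential_short_circuited[of a "{a}" H b]
    by (intro kirchhoff) auto
  ultimately have "(D * C)\<^sup>2 \<le> (D * B) * (A * C)"
    using dirichlet_cauchy_schwarz[OF HE, of ?g ?f] drop by simp
  then have "(D * C) * (D * C) \<le> (D * C) * (A * B)"
    by (simp add: power2_eq_square algebra_simps)
  then have "C * D \<le> A * B"
    using nonneg by (cases "D * C = 0") (auto simp: mult_le_cancel_left mult.commute)
  then show ?thesis unfolding A_def B_def C_def D_def .
qed

lemma family_weight_trees_with_trace:
  assumes "J \<subseteq> E" "K \<subseteq> J"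
  shows "family_weight w {T \<in> spanning_trees V E ends. T \<inter> J = K}
       = edge_set_weight w K * family_weight w (completions (E - J) K)"
proof -
  have "bij_betw (\<lambda>F. F \<union> K) (completions (E - J) K) {T \<in> spanning_trees V E ends. T \<inter> J = K}"
    by (rule bij_betw_byWitness[where f' = "\<lambda>T. T - J"])
       (use assms in \<open>auto simp: completions_def spanning_trees_def spanning_tree_def
          Un_Diff_Int Un_absorb2 intro: back_subst[of "connected_subgraph V ends"]
          back_subst[of "acyclic_subgraph ends"]\<close>)
  then have "family_weight w {T \<in> spanning_trees V E ends. T \<inter> J = K}
      = (\<Sum>F\<in>completions (E - J) K. edge_set_weight w (F \<union> K))"
    unfolding family_weight_def by (rule sum.reindex_bij_betw[symmetric])
  also have "\<dots> = (\<Sum>F\<in>completions (E - J) K. edge_set_weight w K * edge_set_weight w F)"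
  proof (rule sum.cong)
    fix F assume "F \<in> completions (E - J) K"
    then have "F \<subseteq> E" "F \<inter> K = {}" using assms unfolding completions_def by auto
    moreover have "finite F" "finite K"
      using calculation assms finite_edges by (meson finite_subset subset_trans)+
    ultimately show "edge_set_weight w (F \<union> K) = edge_set_weight w K * edge_set_weight w F"
      unfolding edge_set_weight_def by (simp add: prod.union_disjoint)
  qed simp
  finally show ?thesis unfolding family_weight_def by (simp add: sum_distrib_left)
qed

end

section \<open>Negative correlation of two edges\<close>

theorem theorem1:
  fixes V :: "'v set" and E :: "'e set" and ends :: "'e \<Rightarrow> 'v uprod"
    and w :: "'e \<Rightarrow> real" and e\<^sub>1 e\<^sub>2 :: 'e
  assumes "finite_multigraph V E ends"
    and "\<And>e. e \<in> E \<Longrightarrow> w e > 0"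
    and "e\<^sub>1 \<in> E" and "e\<^sub>2 \<in> E" and "e\<^sub>1 \<noteq> e\<^sub>2"
  shows "family_weight w {T \<in> spanning_trees V E ends. e\<^sub>1 \<in> T \<and> e\<^sub>2 \<notin> T}
       * family_weight w {T \<in> spanning_trees V E ends. e\<^sub>1 \<notin> T \<and> e\<^sub>2 \<in> T}
     \<ge> family_weight w {T \<in> spanning_trees V E ends. e\<^sub>1 \<in> T \<and> e\<^sub>2 \<in> T}
       * family_weight w {T \<in> spanning_trees V E ends. e\<^sub>1 \<notin> T \<and> e\<^sub>2 \<notin> T}"
proof -
  have "\<exists>uv. ends e = Upair (fst uv) (snd uv)" for e
    by (cases "ends e" rule: uprod_exhaust) auto
  then obtain uv where "\<And>e. ends e = Upair (fst (uv e)) (snd (uv e))" by metis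
  then interpret oriented_network V E ends "fst \<circ> uv" "snd \<circ> uv" w
    using assms by (intro oriented_network.intro oriented_network_axioms.intro) auto
  let ?J = "{e\<^sub>1, e\<^sub>2}" and ?\<T> = "spanning_trees V E ends"
  have J: "?J \<subseteq> E" using assms by simp
  have traces:
    "{T \<in> ?\<T>. e\<^sub>1 \<in> T \<and> e\<^sub>2 \<notin> T} = {T \<in> ?\<T>. T \<inter> ?J = {e\<^sub>1}}"
    "{T \<in> ?\<T>. e\<^sub>1 \<notin> T \<and> e\<^sub>2 \<in> T} = {T \<in> ?\<T>. T \<inter> ?J = {e\<^sub>2}}"
    "{T \<in> ?\<T>. e\<^sub>1 \<in> T \<and> e\<^sub>2 \<in> T} = {T \<in> ?\<T>. T \<inter> ?J = ?J}"
    "{T \<in> ?\<T>. e\<^sub>1 \<notin> T \<and> e\<^sub>2 \<notin> T} = {T \<in> ?\<T>. T \<inter> ?J = {}}"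
    using assms(5) by auto
  let ?t = "\<lambda>K. family_weight w (completions (E - ?J) K)"
  have "(w e\<^sub>1 * w e\<^sub>2) * (?t ?J * ?t {}) \<le> (w e\<^sub>1 * w e\<^sub>2) * (?t {e\<^sub>1} * ?t {e\<^sub>2})"
    using assms weight_pos
    by (intro mult_left_mono completions_rayleigh) (auto intro: less_imp_le)
  then show ?thesis
    using assms(5) unfolding traces
    by (simp add: family_weight_trees_with_trace[OF J] edge_set_weight_def mult_ac
        del: disjoint_insert)
qed

end
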